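(* Let $\rho$ be a certainty equivalent that is continuous from below, $L:\mathcal{D}\to\mathbb{R}$ an increasing loss function and $C\in\mathbb{R}$ with $C>L(0)$, and consider the notion of validity given, for every family of tests $\phi$ and every data-dependent level $\widetilde{\alpha}$, by $$\phi \text{ is valid for } \widetilde{\alpha} \iff \rho\big(\mathbb{E}^P[L(\phi(\widetilde{\alpha}))\mid\widetilde{\alpha}]\big)\le C .$$ Assume that this notion of validity nests classical validity, preserves classical validity, and is monotone. Write $\overline{L}(x)=(L(x)-L(0))/(C-L(0))$ for $x\in\mathcal{D}$. Then $\overline{L}(0)=0$, $\overline{L}(d_\alpha)=1/\alpha$ for every $\alpha\in(0,1)$, and an E-value $\varepsilon:\mathcal{X}\to\mathcal{D}$ is valid if and only if $$\mathbb{E}^P[\overline{L}(\varepsilon)]\le 1 .$$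
   Context: Setting. $\mathcal{X}$ is the sample space, equipped with a probability distribution $P$ (the simple null hypothesis). External randomization is available throughout: the probability space may be enriched, whenever needed, with a random variable $U\sim\mathrm{Unif}[0,1]$ independent of any other random variables being considered; equivalently, treat the underlying probability space as rich enough that for every finite family of random variables there is on it a $\mathrm{Unif}[0,1]$ random variable independent of that family. Random variables are identified when $P$-almost surely equal (in particular as arguments of $\rho$), and all maps whose probabilities or expectations are considered are assumed measurable. Conditional expectations of random variables bounded from below are taken in the generalized sense, with values in $(-\infty,\infty]$. Evidence space. $\mathcal{D}=\{0\}\cup\{d_\alpha:\alpha\in(0,1)\}$ is a totally ordered set with least element $0$ (a non-rejection), where $d_\alpha$ is the decision to reject at level $\alpha$, and $d_{\alpha^+}\le d_{\alpha^-}$ whenever $\alpha^-\le\alpha^+$. Tests. A family of tests $\phi$ is a collection of random variables $\phi(\alpha):\mathcal{X}\to\{0,d_\alpha\}$, $\alpha\in(0,1)$. A data-dependent level is a random variable $\widetilde{\alpha}:\mathcal{X}\to(0,1)$, and $\phi(\widetilde{\alpha})$ denotes the $\mathcal{D}$-valued map $x\mapsto\phi(\widetilde{\alpha}(x))(x)$. Classical validity: $\phi$ is valid at the (fixed) level $\alpha$ if $P(\phi(\alpha)=d_\alpha)\le\alpha$. Certainty equivalents. A certainty equivalent is a map $\rho$ from $[L(0),\infty]$-valued random variables to $[L(0),\infty]$ such that $X\equiv c$ implies $\rho(X)=c$. It is continuous from below if $Y_n\uparrow Y$ implies $\rho(Y_n)\uparrow\rho(Y)$. Axioms for a notion of validity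 "$\phi$ is valid for $\widetilde{\alpha}$": (Nesting classical validity) for every $\alpha\in(0,1)$ and every family of tests $\phi$, $\phi$ is valid for the constant level $\widetilde{\alpha}\equiv\alpha$ if and only if $P(\phi(\alpha)=d_\alpha)\le\alpha$. (Preserving classical validity) for all $\phi,\widetilde{\alpha}$: if $\phi$ is valid for $\widetilde{\alpha}$, then $P(\phi(\widetilde{\alpha})\ge d_\alpha)\le\alpha$ for every $\alpha\in(0,1)$. (Monotonicity) for all $\phi,\widetilde{\alpha},\widetilde{\alpha}'$: if $\phi$ is valid for $\widetilde{\alpha}$ and $\phi(\widetilde{\alpha}')\le\phi(\widetilde{\alpha})$ pointwise, then $\phi$ is valid for $\widetilde{\alpha}'$. E-values. An E-value is a random variable $\varepsilon:\mathcal{X}\to\mathcal{D}$. It induces the family of tests $\phi_\varepsilon(\alpha)=d_\alpha\,\mathbb{I}\{\varepsilon\ge d_\alpha\}$ (that is, $d_\alpha$ where $\varepsilon\ge d_\alpha$ and $0$ elsewhere) and the data-dependent level $\widetilde{\alpha}_\varepsilon$ that equals $a$ where $\varepsilon=d_a$ and equals some arbitrary value $c\in(0,1)$ where $\varepsilon=0$ (the $d_a$ represent different decisions at different levels, so $a$ is determined by $d_a$). The E-value $\varepsilon$ is called valid if $\phi_\varepsilon$ is valid for $\widetilde{\alpha}_\varepsilon$. *)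

theory Defs
  imports "HOL-Probability.Probability"
begin

text \<open>
  The type \<open>'d\<close> is the evidence space; its least element \<open>bot\<close> is the non-rejection and \<open>d \<alpha>\<close> is
  the rejection at level \<open>\<alpha>\<close>. Only levels in the open unit interval matter: values of \<open>d\<close> and of
  families of tests at other reals are never used. Injectivity says that rejections at different
  levels are different decisions; together with antitonicity it yields \<open>d \<alpha> \<noteq> bot\<close>.
\<close>

locale evidence_space =
  fixes d :: "real \<Rightarrow> 'd::{linorder, order_bot}"
  assumes UNIV_eq: "UNIV = insert bot (d ` {0<..<1})"
    and antitone: "antimono_on {0<..<1} d"
    and inj: "inj_on d {0<..<1}"

text \<open>
  A map into \<open>'d\<close> is measurable iff all events that it is at least \<open>d \<alpha>\<close> are; these upper rays
  generate all order intervals of \<open>'d\<close>, so this is its order Borel structure.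
\<close>

definition decision_algebra :: "(real \<Rightarrow> 'd::{linorder, order_bot}) \<Rightarrow> 'd measure" where
  "decision_algebra d = sigma UNIV {{d \<alpha>..} |\<alpha>. \<alpha> \<in> {0<..<1}}"

definition test_family ::
    "'a measure \<Rightarrow> (real \<Rightarrow> 'd::{linorder, order_bot}) \<Rightarrow> (real \<Rightarrow> 'a \<Rightarrow> 'd) \<Rightarrow> bool" where
  "test_family M d \<phi> \<longleftrightarrow>
     (\<forall>\<alpha>\<in>{0<..<1}. \<phi> \<alpha> \<in> M \<rightarrow>\<^sub>M decision_algebra d \<and> (\<forall>x\<in>space M. \<phi> \<alpha> x \<in> {bot, d \<alpha>}))"

definition data_level :: "'a measure \<Rightarrow> ('a \<Rightarrow> real) \<Rightarrow> bool" where
  "data_level M a \<longleftrightarrow> a \<in> borel_measurable M \<and> (\<forall>x\<in>space M. a x \<in> {0<..<1})"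

definition test_at :: "(real \<Rightarrow> 'a \<Rightarrow> 'd) \<Rightarrow> ('a \<Rightarrow> real) \<Rightarrow> 'a \<Rightarrow> 'd" where
  "test_at \<phi> a = (\<lambda>x. \<phi> (a x) x)"

text \<open>
  Measurability of every single test does not make \<open>test_at \<phi> a\<close> measurable (the levels are
  uncountable), so it is required of the pairs to which a notion of validity is applied.
\<close>

definition admissible ::
    "'a measure \<Rightarrow> (real \<Rightarrow> 'd::{linorder, order_bot}) \<Rightarrow> (real \<Rightarrow> 'a \<Rightarrow> 'd) \<Rightarrow> ('a \<Rightarrow> real) \<Rightarrow> bool" where
  "admissible M d \<phi> a \<longleftrightarrow>
     test_family M d \<phi> \<and> data_level M a \<and> test_at \<phi> a \<in> M \<rightarrow>\<^sub>M decision_algebra d"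

text \<open>
  For every finite family of random variables there is a uniform one independent of the family.
  Real-valued families suffice, since the values of the other random variables considered
  (decisions, extended reals) can be encoded measurably by reals.
\<close>

definition rich :: "'a measure \<Rightarrow> bool" where
  "rich M \<longleftrightarrow>
     (\<forall>(n::nat) (X :: nat \<Rightarrow> 'a \<Rightarrow> real). (\<forall>i<n. X i \<in> borel_measurable M) \<longrightarrow>
       (\<exists>U :: 'a \<Rightarrow> real. U \<in> borel_measurable M \<and>
          distr M borel U = uniform_measure lborel {0..1} \<and>
          prob_space.indep_set M
            (sets (vimage_algebra (space M) U borel))
            (sets (vimage_algebra (space M) (\<lambda>x. \<lambda>i\<in>{..<n}. X i x)
               (Pi\<^sub>M {..<n} (\<lambda>_. borel))))))"

definition rv_above :: "'a measure \<Rightarrow> real \<Rightarrow> ('a \<Rightarrow> ereal) set" where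
  "rv_above M b = {X \<in> borel_measurable M. AE x in M. ereal b \<le> X x}"

text \<open>
  The second conjunct makes \<open>\<rho>\<close> a function of almost sure equivalence classes. There is no
  constraint on \<open>\<rho>\<close> outside \<open>rv_above M b\<close>.
\<close>

definition certainty_equivalent :: "'a measure \<Rightarrow> real \<Rightarrow> (('a \<Rightarrow> ereal) \<Rightarrow> ereal) \<Rightarrow> bool" where
  "certainty_equivalent M b \<rho> \<longleftrightarrow>
     (\<forall>X\<in>rv_above M b. ereal b \<le> \<rho> X) \<and>
     (\<forall>X\<in>rv_above M b. \<forall>Y\<in>rv_above M b. (AE x in M. X x = Y x) \<longrightarrow> \<rho> X = \<rho> Y) \<and>
     (\<forall>X\<in>rv_above M b. \<forall>c. (AE x in M. X x = c) \<longrightarrow> \<rho> X = c)"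

definition continuous_from_below :: "'a measure \<Rightarrow> real \<Rightarrow> (('a \<Rightarrow> ereal) \<Rightarrow> ereal) \<Rightarrow> bool" where
  "continuous_from_below M b \<rho> \<longleftrightarrow>
     (\<forall>Y Z. (\<forall>n. Y n \<in> rv_above M b) \<and> Z \<in> rv_above M b \<and>
        (AE x in M. incseq (\<lambda>n. Y n x) \<and> (\<lambda>n. Y n x) \<longlonglongrightarrow> Z x) \<longrightarrow>
        incseq (\<lambda>n. \<rho> (Y n)) \<and> (\<lambda>n. \<rho> (Y n)) \<longlonglongrightarrow> \<rho> Z)"

text \<open>
  Generalized conditional expectation: positive minus negative part. If \<open>f\<close> is bounded from below
  then the negative part is almost surely finite and the difference is meaningful; unlike
  \<open>real_cond_exp\<close> it takes the value \<open>\<infinity>\<close> where the positive part does.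
\<close>

definition gen_cond_exp :: "'a measure \<Rightarrow> 'a measure \<Rightarrow> ('a \<Rightarrow> real) \<Rightarrow> 'a \<Rightarrow> ereal" where
  "gen_cond_exp M F f = (\<lambda>x.
     enn2ereal (nn_cond_exp M F (\<lambda>x. ennreal (f x)) x) -
     enn2ereal (nn_cond_exp M F (\<lambda>x. ennreal (- f x)) x))"

definition loss_valid ::
    "'a measure \<Rightarrow> (('a \<Rightarrow> ereal) \<Rightarrow> ereal) \<Rightarrow> ('d \<Rightarrow> real) \<Rightarrow> real \<Rightarrow>
      (real \<Rightarrow> 'a \<Rightarrow> 'd) \<Rightarrow> ('a \<Rightarrow> real) \<Rightarrow> bool" where
  "loss_valid M \<rho> L C \<phi> a \<longleftrightarrow>
     \<rho> (gen_cond_exp M (vimage_algebra (space M) a borel) (\<lambda>x. L (test_at \<phi> a x))) \<le> ereal C"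

definition nests_classical ::
    "'a measure \<Rightarrow> (real \<Rightarrow> 'd::{linorder, order_bot}) \<Rightarrow>
      ((real \<Rightarrow> 'a \<Rightarrow> 'd) \<Rightarrow> ('a \<Rightarrow> real) \<Rightarrow> bool) \<Rightarrow> bool" where
  "nests_classical M d valid \<longleftrightarrow>
     (\<forall>\<alpha>\<in>{0<..<1}. \<forall>\<phi>. test_family M d \<phi> \<longrightarrow>
        (valid \<phi> (\<lambda>_. \<alpha>) \<longleftrightarrow> measure M {x \<in> space M. \<phi> \<alpha> x = d \<alpha>} \<le> \<alpha>))"

definition preserves_classical ::
    "'a measure \<Rightarrow> (real \<Rightarrow> 'd::{linorder, order_bot}) \<Rightarrow>
      ((real \<Rightarrow> 'a \<Rightarrow> 'd) \<Rightarrow> ('a \<Rightarrow> real) \<Rightarrow> bool) \<Rightarrow> bool" where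
  "preserves_classical M d valid \<longleftrightarrow>
     (\<forall>\<phi> a. admissible M d \<phi> a \<and> valid \<phi> a \<longrightarrow>
        (\<forall>\<alpha>\<in>{0<..<1}. measure M {x \<in> space M. d \<alpha> \<le> test_at \<phi> a x} \<le> \<alpha>))"

definition monotone_validity ::
    "'a measure \<Rightarrow> (real \<Rightarrow> 'd::{linorder, order_bot}) \<Rightarrow>
      ((real \<Rightarrow> 'a \<Rightarrow> 'd) \<Rightarrow> ('a \<Rightarrow> real) \<Rightarrow> bool) \<Rightarrow> bool" where
  "monotone_validity M d valid \<longleftrightarrow>
     (\<forall>\<phi> a a'. admissible M d \<phi> a \<and> admissible M d \<phi> a' \<and> valid \<phi> a \<and>
        (\<forall>x\<in>space M. test_at \<phi> a' x \<le> test_at \<phi> a x) \<longrightarrow> valid \<phi> a')"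

definition induced_tests ::
    "(real \<Rightarrow> 'd::{linorder, order_bot}) \<Rightarrow> ('a \<Rightarrow> 'd) \<Rightarrow> real \<Rightarrow> 'a \<Rightarrow> 'd" where
  "induced_tests d \<epsilon> \<alpha> x = (if d \<alpha> \<le> \<epsilon> x then d \<alpha> else bot)"

definition induced_level ::
    "(real \<Rightarrow> 'd::{linorder, order_bot}) \<Rightarrow> real \<Rightarrow> ('a \<Rightarrow> 'd) \<Rightarrow> 'a \<Rightarrow> real" where
  "induced_level d c \<epsilon> x = (if \<epsilon> x = bot then c else the_inv_into {0<..<1} d (\<epsilon> x))"

definition e_value_valid ::
    "(real \<Rightarrow> 'd::{linorder, order_bot}) \<Rightarrow> ((real \<Rightarrow> 'a \<Rightarrow> 'd) \<Rightarrow> ('a \<Rightarrow> real) \<Rightarrow> bool) \<Rightarrow>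
      real \<Rightarrow> ('a \<Rightarrow> 'd) \<Rightarrow> bool" where
  "e_value_valid d valid c \<epsilon> \<longleftrightarrow> valid (induced_tests d \<epsilon>) (induced_level d c \<epsilon>)"

definition normalized_loss :: "('d::order_bot \<Rightarrow> real) \<Rightarrow> real \<Rightarrow> 'd \<Rightarrow> real" where
  "normalized_loss L C x = (L x - L bot) / (C - L bot)"

end

theory Submission
  imports Defs "HOL-Real_Asymp.Real_Asymp"
begin

text \<open>
  Nesting, applied to a randomized rejection of probability \<open>p\<close> at a fixed level \<open>\<alpha>\<close>, makes
  \<open>p (L (d \<alpha>) - L bot) \<le> C - L bot\<close> equivalent to \<open>p \<le> \<alpha>\<close> and thereby determines \<open>L\<close>.

  Let \<open>K = C - L bot\<close> and let \<open>z\<close> be a bounded nonnegative conditional excess loss. Encode \<open>z\<close>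
  injectively in a data-dependent level \<open>V\<close> with values in a short interval \<open>[lo, hi]\<close> near \<open>0\<close>, and
  reject when an independent uniform variable is at most \<open>z V / K\<close>; this pair has conditional excess
  loss \<open>z\<close> again, while its rejection probability is \<open>E[z V] / K\<close>. If it is valid, preservation
  at \<open>hi\<close> gives \<open>E[z V] / K \<le> hi\<close>. Conversely, the same rejection region is valid at the constant level
  \<open>lo\<close> if \<open>E[z V] / K \<le> lo\<close>, and monotonicity transfers this to \<open>V\<close>. As \<open>lo / hi\<close> tends to \<open>1\<close>,
  validity becomes \<open>E[z] \<le> K\<close>, up to the boundary case, which, like unbounded \<open>z\<close>, is reached by
  continuity from below along \<open>min z n * n / (n + 1)\<close>.
\<close>

section \<open>Randomization by a uniform variable and conditional expectations\<close>

text \<open>By independence the law of \<open>(U, V)\<close> is a product, and for fixed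
  \<open>v\<close> the inner integral over \<open>u\<close> is the length of
  \<open>{0..q v}\<close>. The weight \<open>w\<close> is arbitrary so that the identity can be
  localized to events about \<open>V\<close>.\<close>

lemma (in prob_space) nn_integral_uniform_threshold:
  fixes U V q :: "_ \<Rightarrow> real" and w :: "real \<Rightarrow> ennreal"
  assumes indep: "indep_var borel U borel V"
    and U: "distr M borel U = uniform_measure lborel {0..1}"
    and [measurable]: "w \<in> borel_measurable borel" "q \<in> borel_measurable borel"
    and q: "\<And>x. x \<in> space M \<Longrightarrow> q (V x) \<in> {0..1}"
  shows "(\<integral>\<^sup>+x. w (V x) * indicator {..q (V x)} (U x) \<partial>M) = (\<integral>\<^sup>+x. w (V x) * ennreal (q (V x)) \<partial>M)"
proof -
  have [measurable]: "random_variable borel U" "random_variable borel V"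
    using indep_var_rv1[OF indep] indep_var_rv2[OF indep] by auto
  interpret U: prob_space "distr M borel U" by (rule prob_space_distr) simp
  interpret V: prob_space "distr M borel V" by (rule prob_space_distr) simp
  interpret UV: pair_sigma_finite "distr M borel U" "distr M borel V" ..
  \<comment> \<open>The threshold event is written as one subset of the plane, which makes joint
    measurability automatic; the set \<open>{..q v}\<close> varies with \<open>v\<close>.\<close>
  let ?f = "\<lambda>(u, v). w v * indicator {p. fst p \<le> q (snd p)} (u, v)"
  have f [measurable]: "?f \<in> borel_measurable (borel \<Otimes>\<^sub>M borel)"
    by measurable
  have inner: "(\<integral>\<^sup>+u. w v * indicator {..q v} u \<partial>distr M borel U) = w v * ennreal (q v)"
    if "q v \<in> {0..1}" for v
  proof -
    have "(\<integral>\<^sup>+u. w v * indicator {..q v} u \<partial>distr M borel U) = w v * emeasure (distr M borel U) {..q v}"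
      by (subst nn_integral_cmult_indicator) auto
    also have "emeasure (distr M borel U) {..q v} = emeasure lborel {0..q v}"
    proof -
      have "min 1 (q v) = q v" using that by auto
      then show ?thesis by (simp add: U divide_ennreal_def)
    qed
    finally show ?thesis using that by simp
  qed
  have "(\<integral>\<^sup>+x. w (V x) * indicator {..q (V x)} (U x) \<partial>M) = (\<integral>\<^sup>+x. ?f (U x, V x) \<partial>M)"
    by (intro nn_integral_cong) (auto simp: indicator_def)
  also have "\<dots> = integral\<^sup>N (distr M (borel \<Otimes>\<^sub>M borel) (\<lambda>x. (U x, V x))) ?f"
    by (subst nn_integral_distr) auto
  also have "\<dots> = integral\<^sup>N (distr M borel U \<Otimes>\<^sub>M distr M borel V) ?f"
    using indep by (simp add: indep_var_distribution_eq)
  also have "\<dots> = (\<integral>\<^sup>+v. (\<integral>\<^sup>+u. ?f (u, v) \<partial>distr M borel U) \<partial>distr M borel V)"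
    by (rule UV.nn_integral_snd[symmetric]) simp
  also have "\<dots> = (\<integral>\<^sup>+x. (\<integral>\<^sup>+u. ?f (u, V x) \<partial>distr M borel U) \<partial>M)"
    by (subst nn_integral_distr) auto
  also have "\<dots> = (\<integral>\<^sup>+x. (\<integral>\<^sup>+u. w (V x) * indicator {..q (V x)} u \<partial>distr M borel U) \<partial>M)"
    by (intro nn_integral_cong) (auto simp: indicator_def)
  also have "\<dots> = (\<integral>\<^sup>+x. w (V x) * ennreal (q (V x)) \<partial>M)"
    using inner q by (intro nn_integral_cong) auto
  finally show ?thesis .
qed

lemma (in prob_space) sigma_finite_subalgebra_vimage:
  fixes V :: "'a \<Rightarrow> real"
  assumes "V \<in> borel_measurable M"
  shows "sigma_finite_subalgebra M (vimage_algebra (space M) V borel)"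
proof -
  have "subalgebra M (vimage_algebra (space M) V borel)"
    using sets_image_in_sets[of M "space M" V borel] assms by (auto simp: subalgebra_def)
  then interpret finite_measure_subalgebra M "vimage_algebra (space M) V borel"
    by unfold_locales
  show ?thesis ..
qed

text \<open>The events of the generated algebra are preimages of Borel sets \<open>B\<close> under
  \<open>V\<close>. The indicator of \<open>B\<close> can be absorbed into the weight, so the
  preceding integral identity is the characterizing property of the conditional expectation.\<close>

lemma (in prob_space) nn_cond_exp_uniform_threshold:
  fixes U V q :: "_ \<Rightarrow> real" and w :: "real \<Rightarrow> ennreal"
  assumes indep: "indep_var borel U borel V"
    and U: "distr M borel U = uniform_measure lborel {0..1}"
    and [measurable]: "w \<in> borel_measurable borel" "q \<in> borel_measurable borel"
    and q: "\<And>x. x \<in> space M \<Longrightarrow> q (V x) \<in> {0..1}"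
  shows "AE x in M. nn_cond_exp M (vimage_algebra (space M) V borel)
      (\<lambda>x. w (V x) * indicator {..q (V x)} (U x)) x = w (V x) * ennreal (q (V x))"
proof -
  let ?F = "vimage_algebra (space M) V borel"
  have [measurable]: "random_variable borel U" "random_variable borel V"
    using indep_var_rv1[OF indep] indep_var_rv2[OF indep] by auto
  interpret sigma_finite_subalgebra M ?F
    by (rule sigma_finite_subalgebra_vimage) simp
  have V [measurable]: "V \<in> borel_measurable ?F"
    by (rule measurable_vimage_algebra1) auto
  have 1: "(\<lambda>x. w (V x) * indicator {p. fst p \<le> q (snd p)} (U x, V x)) \<in> borel_measurable M"
    by measurable
  have "AE x in M. w (V x) * ennreal (q (V x)) =
      nn_cond_exp M ?F (\<lambda>x. w (V x) * indicator {..q (V x)} (U x)) x"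
  proof (rule nn_cond_exp_charact)
    fix A assume "A \<in> sets ?F"
    then obtain B where B [measurable]: "B \<in> sets borel" and A: "A = V -` B \<inter> space M"
      by (auto simp: sets_vimage_algebra2)
    have "(\<integral>\<^sup>+x\<in>A. (w (V x) * indicator {..q (V x)} (U x)) \<partial>M)
        = (\<integral>\<^sup>+x. (w (V x) * indicator B (V x)) * indicator {..q (V x)} (U x) \<partial>M)"
      by (intro nn_integral_cong) (auto simp: A indicator_def)
    also have "\<dots> = (\<integral>\<^sup>+x. (w (V x) * indicator B (V x)) * ennreal (q (V x)) \<partial>M)"
      by (rule nn_integral_uniform_threshold[OF indep U, of "\<lambda>v. w v * indicator B v"]) (use q in auto)
    also have "\<dots> = (\<integral>\<^sup>+x\<in>A. (w (V x) * ennreal (q (V x))) \<partial>M)"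
      by (intro nn_integral_cong) (auto simp: A indicator_def)
    finally show "(\<integral>\<^sup>+x\<in>A. (w (V x) * indicator {..q (V x)} (U x)) \<partial>M) = \<dots>" .
  next
    have "(\<lambda>x. w (V x) * indicator {..q (V x)} (U x)) =
        (\<lambda>x. w (V x) * indicator {p. fst p \<le> q (snd p)} (U x, V x))"
      by (auto simp: indicator_def)
    then show "(\<lambda>x. w (V x) * indicator {..q (V x)} (U x)) \<in> borel_measurable M"
      using 1 by simp
  qed measurable
  then show ?thesis by auto
qed

text \<open>Positive and negative parts are not additive, so the constant cannot simply be pulled
  out. Instead, an identity between sums of nonnegative terms is conditioned term by term, and
  subtraction takes place only after finiteness of the negative part is known.\<close>

lemma (in sigma_finite_subalgebra) gen_cond_exp_add_const:
  fixes g :: "'a \<Rightarrow> real"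
  assumes [measurable]: "g \<in> borel_measurable M" and g: "\<And>x. 0 \<le> g x"
  shows "AE x in M. gen_cond_exp M F (\<lambda>x. b + g x) x
    = ereal b + enn2ereal (nn_cond_exp M F (\<lambda>x. ennreal (g x)) x)"
proof -
  let ?E = "nn_cond_exp M F"
  let ?p = "\<lambda>x. ennreal (b + g x)" and ?n = "\<lambda>x. ennreal (- (b + g x))"
  have const: "AE x in M. c = ?E (\<lambda>_. c) x" for c
    by (rule nn_cond_exp_F_meas) simp
  have pw: "?p x + ennreal (- b) = ?n x + (ennreal b + ennreal (g x))" for x
  proof (cases "b \<ge> 0")
    case True
    then show ?thesis using g[of x] by (simp add: ennreal_neg ennreal_plus)
  next
    case False
    then show ?thesis using g[of x]
      by (cases "b + g x \<ge> 0") (auto simp: ennreal_neg simp flip: ennreal_plus)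
  qed
  have "AE x in M. ?E ?p x + ?E (\<lambda>_. ennreal (- b)) x = ?E (\<lambda>x. ?p x + ennreal (- b)) x"
    by (rule nn_cond_exp_sum) measurable
  moreover have "AE x in M. ?E ?n x + ?E (\<lambda>x. ennreal b + ennreal (g x)) x
      = ?E (\<lambda>x. ?n x + (ennreal b + ennreal (g x))) x"
    by (rule nn_cond_exp_sum) measurable
  moreover have "AE x in M. ?E (\<lambda>_. ennreal b) x + ?E (\<lambda>x. ennreal (g x)) x
      = ?E (\<lambda>x. ennreal b + ennreal (g x)) x"
    by (rule nn_cond_exp_sum) measurable
  \<comment> \<open>As \<open>g\<close> is nonnegative, the negative part of \<open>b + g\<close> is
    at most that of \<open>b\<close>; hence its conditional expectation is finite and may be
    subtracted.\<close>
  moreover have "AE x in M. ?E ?n x \<le> ?E (\<lambda>_. ennreal (- b)) x"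
    by (rule nn_cond_exp_mono) (auto intro!: AE_I2 ennreal_leI simp: g)
  ultimately show ?thesis
    using const[of "ennreal b"] const[of "ennreal (- b)"]
  proof eventually_elim
    case (elim x)
    have "?E ?p x + ennreal (- b) = ?E ?n x + (ennreal b + ?E (\<lambda>x. ennreal (g x)) x)"
      using elim by (simp add: pw)
    moreover have "?E ?n x \<le> ennreal (- b)"
      using elim by simp
    then obtain n where n: "?E ?n x = ennreal n" "0 \<le> n"
      by (cases "?E ?n x") (auto simp: top_unique)
    ultimately have eq: "?E ?p x + ennreal (- b) = ennreal n + (ennreal b + ?E (\<lambda>x. ennreal (g x)) x)"
      by simp
    show ?case
    proof (cases "?E (\<lambda>x. ennreal (g x)) x")
      case (real r)
      then have "?E ?p x + ennreal (- b) \<noteq> top"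
        using eq by simp
      then obtain p where p: "?E ?p x = ennreal p" "0 \<le> p"
        by (cases "?E ?p x") auto
      \<comment> \<open>\<open>ennreal\<close> sends negative reals to 0, so
        \<open>ennreal b\<close> and \<open>ennreal (- b)\<close> are the two parts of
        \<open>b\<close>, here \<open>max 0 b\<close> and \<open>max 0 (- b)\<close>.\<close>
      have "p + max 0 (- b) = n + (max 0 b + r)"
      proof -
        have "ennreal (p + max 0 (- b)) = ennreal (n + (max 0 b + r))"
          using eq p n real by (simp add: ennreal_plus)
        then show ?thesis using p n real by (subst (asm) ennreal_inj) auto
      qed
      then show ?thesis using p n real
        by (auto simp: gen_cond_exp_def enn2ereal_ennreal)
    next
      case top
      then have "?E ?p x = top" using eq by auto
      then show ?thesis using top n by (simp add: gen_cond_exp_def enn2ereal_ennreal)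
    qed
  qed
qed

text \<open>Richness is applied to the one-element family consisting of \<open>V\<close>. As
  \<open>V\<close> is a coordinate of the tuple, its generated algebra is contained in that of the
  tuple and inherits the independence.\<close>

lemma rich_uniform:
  fixes V :: "'a \<Rightarrow> real"
  assumes "prob_space M" "rich M" and V: "V \<in> borel_measurable M"
  obtains U :: "'a \<Rightarrow> real" where
    "distr M borel U = uniform_measure lborel {0..1}" "prob_space.indep_var M borel U borel V"
proof -
  interpret prob_space M by fact
  let ?T = "\<lambda>x. \<lambda>i\<in>{..<1::nat}. V x"
  let ?A = "vimage_algebra (space M) ?T (Pi\<^sub>M {..<1} (\<lambda>_. borel))"
  obtain U :: "'a \<Rightarrow> real" where U [measurable]: "U \<in> borel_measurable M"
    and distr: "distr M borel U = uniform_measure lborel {0..1}"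
    and indep: "indep_set (sets (vimage_algebra (space M) U borel)) (sets ?A)"
    using \<open>rich M\<close>[unfolded rich_def, rule_format, of 1 "\<lambda>_. V"] V by blast
  have "?T \<in> measurable ?A (Pi\<^sub>M {..<1} (\<lambda>_. borel))"
    by (rule measurable_vimage_algebra1) (auto simp: space_PiM)
  then have "(\<lambda>x. ?T x 0) \<in> borel_measurable ?A"
    by (rule measurable_compose[OF _ measurable_component_singleton]) simp
  then have "sets (vimage_algebra (space M) V borel) \<subseteq> sets ?A"
    by (intro sets_image_in_sets) auto
  then have "indep_set (sets (vimage_algebra (space M) U borel)) (sets (vimage_algebra (space M) V borel))"
    using indep unfolding indep_sets2_eq by blast
  then have "indep_var borel U borel V"
    using V by (simp add: indep_var_eq sets_vimage_algebra)
  then show thesis using that distr by blast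
qed

section \<open>Decisions, rejection regions and measurability\<close>

text \<open>The rejection region is the same at every level; the level only selects which rejection
  is reported. One family can thus be compared at a constant and at a data-dependent level.\<close>

definition region_tests ::
    "(real \<Rightarrow> 'd::order_bot) \<Rightarrow> 'a set \<Rightarrow> real \<Rightarrow> 'a \<Rightarrow> 'd" where
  "region_tests d R \<alpha> x = (if x \<in> R then d \<alpha> else bot)"

lemma measurable_decision_algebraI:
  assumes "\<And>\<alpha>. \<alpha> \<in> {0<..<1} \<Longrightarrow> {x \<in> space M. d \<alpha> \<le> f x} \<in> sets M"
  shows "f \<in> M \<rightarrow>\<^sub>M decision_algebra d"
  unfolding decision_algebra_def
proof (rule measurable_measure_of)
  fix A assume "A \<in> {{d \<alpha>..} |\<alpha>. \<alpha> \<in> {0<..<1}}"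
  then obtain \<alpha> where "\<alpha> \<in> {0<..<1}" "A = {d \<alpha>..}" by blast
  moreover have "f -` {d \<alpha>..} \<inter> space M = {x \<in> space M. d \<alpha> \<le> f x}" by auto
  ultimately show "f -` A \<inter> space M \<in> sets M" using assms by simp
qed auto

lemma measurable_decision_algebraD:
  assumes f: "f \<in> M \<rightarrow>\<^sub>M decision_algebra d" and "\<alpha> \<in> {0<..<1}"
  shows "{x \<in> space M. d \<alpha> \<le> f x} \<in> sets M"
proof -
  have "{d \<alpha>..} \<in> sets (decision_algebra d)"
    using assms(2) by (auto simp: decision_algebra_def)
  from measurable_sets[OF f this] show ?thesis
    by (simp add: vimage_def Int_def conj_commute)
qed

context evidence_space
begin

lemma d_le_iff: "\<lbrakk>a \<in> {0<..<1}; b \<in> {0<..<1}\<rbrakk> \<Longrightarrow> d a \<le> d b \<longleftrightarrow> b \<le> a"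
  using monotone_onD[OF antitone, of a b] monotone_onD[OF antitone, of b a] inj_onD[OF inj, of a b]
  by (metis antisym linear)

lemma d_neq_bot:
  assumes a: "a \<in> {0<..<1}"
  shows "d a \<noteq> bot"
proof
  assume "d a = bot"
  \<comment> \<open>\<open>(a + 1) / 2\<close> is a level strictly above \<open>a\<close>, so its
    rejection lies strictly below \<open>d a\<close>.\<close>
  then have "d a \<le> d ((a + 1) / 2)" by simp
  then show False using a by (subst (asm) d_le_iff) auto
qed

lemma decision_cases [case_names bot reject]:
  obtains "y = bot" | a where "a \<in> {0<..<1}" "y = d a"
  using UNIV_eq by blast

lemma induced_level_d: "a \<in> {0<..<1} \<Longrightarrow> \<epsilon> x = d a \<Longrightarrow> induced_level d c \<epsilon> x = a"
  by (simp add: induced_level_def d_neq_bot the_inv_into_f_f[OF inj])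

lemma induced_level_mem: "c \<in> {0<..<1} \<Longrightarrow> induced_level d c \<epsilon> x \<in> {0<..<1}"
  by (cases "\<epsilon> x" rule: decision_cases) (auto simp: induced_level_d, auto simp: induced_level_def)

lemma d_induced_level: "\<epsilon> x \<noteq> bot \<Longrightarrow> d (induced_level d c \<epsilon> x) = \<epsilon> x"
  by (cases "\<epsilon> x" rule: decision_cases) (auto simp: induced_level_d)

text \<open>The arbitrary level \<open>c\<close> is harmless: where \<epsilon> is
  \<open>bot\<close>, the condition \<open>d c \<le> bot\<close> fails. Elsewhere the induced level
  names the value of \<epsilon> itself.\<close>

lemma test_at_induced:
  assumes c: "c \<in> {0<..<1}"
  shows "test_at (induced_tests d \<epsilon>) (induced_level d c \<epsilon>) = \<epsilon>"
proof
  fix x show "test_at (induced_tests d \<epsilon>) (induced_level d c \<epsilon>) x = \<epsilon> x"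
  proof (cases "\<epsilon> x = bot")
    case True
    then show ?thesis
      using d_neq_bot[OF c] by (simp add: test_at_def induced_tests_def induced_level_def bot_unique)
  next
    case False
    then show ?thesis by (simp add: test_at_def induced_tests_def d_induced_level)
  qed
qed

lemma measurable_eq_bot:
  assumes "\<epsilon> \<in> M \<rightarrow>\<^sub>M decision_algebra d"
  shows "{x \<in> space M. \<epsilon> x = bot} \<in> sets M"
proof -
  \<comment> \<open>These levels increase to 1, so countably many generating rays exhaust all
    rejections. The shift by 2 keeps the level positive at \<open>n = 0\<close>.\<close>
  let ?b = "\<lambda>n. 1 - 1 / real (n + 2)"
  have b: "?b n \<in> {0<..<1}" for n by auto
  have "{x \<in> space M. \<epsilon> x = bot} = space M - (\<Union>n. {x \<in> space M. d (?b n) \<le> \<epsilon> x})"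
  proof -
    have "\<epsilon> x = bot \<longleftrightarrow> (\<forall>n. \<not> d (?b n) \<le> \<epsilon> x)" for x
    proof (cases "\<epsilon> x" rule: decision_cases)
      case bot
      then show ?thesis using d_neq_bot[OF b] by (simp add: bot_unique)
    next
      case (reject a)
      obtain n where "inverse (real (Suc n)) < 1 - a"
        using reject(1) reals_Archimedean[of "1 - a"] by auto
      moreover have "1 / real (n + 2) \<le> inverse (real (Suc n))"
        by (simp add: field_simps)
      ultimately have "a \<le> ?b n" by linarith
      then have "d (?b n) \<le> \<epsilon> x" using reject b by (simp add: d_le_iff)
      then show ?thesis using reject d_neq_bot by auto
    qed
    then show ?thesis by auto
  qed
  also have "\<dots> \<in> sets M"
    using measurable_decision_algebraD[OF assms b] by auto
  finally show ?thesis .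
qed

lemma measurable_induced_level:
  assumes \<epsilon>: "\<epsilon> \<in> M \<rightarrow>\<^sub>M decision_algebra d" and c: "c \<in> {0<..<1}"
  shows "induced_level d c \<epsilon> \<in> borel_measurable M"
proof (rule borel_measurableI_le)
  fix t :: real
  let ?l = "induced_level d c \<epsilon>"
  have l: "0 < ?l x" "?l x < 1" for x
    using induced_level_mem[OF c, of \<epsilon> x] by auto
  consider "t \<le> 0" | "t \<ge> 1" | "t \<in> {0<..<1}" by fastforce
  then show "{x \<in> space M. ?l x \<le> t} \<in> sets M"
  proof cases
    case 1
    then have "{x \<in> space M. ?l x \<le> t} = {}"
      by (auto simp: not_le intro: le_less_trans[OF _ l(1)])
    then show ?thesis by (simp only: sets.empty_sets)
  next
    case 2
    have "?l x \<le> t" for x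
      using l(2)[of x] 2 by linarith
    then have "{x \<in> space M. ?l x \<le> t} = space M"
      by blast
    then show ?thesis by simp
  next
    case t: 3
    have "?l x \<le> t \<longleftrightarrow> d t \<le> \<epsilon> x \<or> \<epsilon> x = bot \<and> c \<le> t" for x
    proof (cases "\<epsilon> x" rule: decision_cases)
      case bot
      then show ?thesis using d_neq_bot[OF t] by (simp add: bot_unique induced_level_def)
    next
      case (reject a)
      then show ?thesis using t d_neq_bot by (simp add: induced_level_d d_le_iff)
    qed
    then have "{x \<in> space M. ?l x \<le> t} =
        {x \<in> space M. d t \<le> \<epsilon> x} \<union> (if c \<le> t then {x \<in> space M. \<epsilon> x = bot} else {})"
      by auto
    then show ?thesis
      using measurable_decision_algebraD[OF \<epsilon> t] measurable_eq_bot[OF \<epsilon>] by simp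
  qed
qed

lemma test_at_region_le_iff:
  "\<alpha> \<in> {0<..<1} \<Longrightarrow> a x \<in> {0<..<1} \<Longrightarrow>
    d \<alpha> \<le> test_at (region_tests d R) a x \<longleftrightarrow> x \<in> R \<and> a x \<le> \<alpha>"
  using d_neq_bot[of \<alpha>] by (auto simp: test_at_def region_tests_def d_le_iff bot_unique)

text \<open>The event that the reported decision is at least \<open>d \<alpha>\<close> is the part
  of \<open>R\<close> where the level is at most \<alpha>, so the uncountability of the levels
  causes no difficulty.\<close>

lemma admissible_region_tests:
  assumes R: "R \<in> sets M" and a: "data_level M a"
  shows "admissible M d (region_tests d R) a"
  unfolding admissible_def
proof (intro conjI a)
  have meas: "test_at (region_tests d R) b \<in> M \<rightarrow>\<^sub>M decision_algebra d" if b: "data_level M b" for b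
  proof (rule measurable_decision_algebraI)
    fix \<alpha> :: real assume "\<alpha> \<in> {0<..<1}"
    then have "{x \<in> space M. d \<alpha> \<le> test_at (region_tests d R) b x} = R \<inter> {x \<in> space M. b x \<le> \<alpha>}"
      using b sets.sets_into_space[OF R] by (auto simp: test_at_region_le_iff data_level_def)
    also have "\<dots> \<in> sets M"
    proof -
      have [measurable]: "b \<in> borel_measurable M" using b by (simp add: data_level_def)
      show ?thesis using R by measurable
    qed
    finally show "{x \<in> space M. d \<alpha> \<le> test_at (region_tests d R) b x} \<in> sets M" .
  qed
  from meas[OF a] show "test_at (region_tests d R) a \<in> M \<rightarrow>\<^sub>M decision_algebra d" .
  \<comment> \<open>A single test is the family evaluated at a constant data-dependent
    level.\<close>
  have "region_tests d R \<alpha> \<in> M \<rightarrow>\<^sub>M decision_algebra d" if "\<alpha> \<in> {0<..<1}" for \<alpha>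
    using meas[of "\<lambda>_. \<alpha>"] that by (simp add: data_level_def test_at_def)
  then show "test_family M d (region_tests d R)"
    by (auto simp: test_family_def region_tests_def)
qed

end

section \<open>Conditional losses and the loss function forced by nesting\<close>

text \<open>Continuity from below, preservation and monotonicity enter as explicit hypotheses
  further down, which shows where each of them acts.\<close>

locale nested_loss_validity = prob_space M + evidence_space d
  for M :: "'a measure" and d :: "real \<Rightarrow> 'd::{linorder, order_bot}" +
  fixes \<rho> :: "('a \<Rightarrow> ereal) \<Rightarrow> ereal" and L :: "'d \<Rightarrow> real" and C :: real
  assumes rich: "rich M"
    and mono_L: "mono L"
    and L_bot_less: "L bot < C"
    and certainty: "certainty_equivalent M (L bot) \<rho>"
    and nests: "nests_classical M d (loss_valid M \<rho> L C)"
begin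

lemma L_bot_le: "L bot \<le> L y"
  using mono_L by (rule monoD) simp

lemma rho_cong:
  assumes "f \<in> borel_measurable M" "g \<in> borel_measurable M"
    and "AE x in M. f x = g x" "AE x in M. ereal (L bot) \<le> g x"
  shows "\<rho> f = \<rho> g"
proof -
  have "AE x in M. ereal (L bot) \<le> f x"
    using assms(3,4) by eventually_elim simp
  then show ?thesis
    using certainty assms unfolding certainty_equivalent_def rv_above_def by blast
qed

text \<open>As \<open>L\<close> is least at \<open>bot\<close>, the loss is \<open>L bot\<close>
  plus a nonnegative excess, and only the excess has to be conditioned. Since \<open>\<rho>\<close>
  respects almost sure equality, any version \<open>g\<close> of that conditional expectation will
  do.\<close>

lemma loss_valid_iff:
  assumes a [measurable]: "a \<in> borel_measurable M"
    and [measurable]: "(\<lambda>x. L (test_at \<phi> a x)) \<in> borel_measurable M"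
    and g [measurable]: "g \<in> borel_measurable M"
    and eq: "AE x in M. nn_cond_exp M (vimage_algebra (space M) a borel)
        (\<lambda>x. ennreal (L (test_at \<phi> a x) - L bot)) x = g x"
  shows "loss_valid M \<rho> L C \<phi> a \<longleftrightarrow> \<rho> (\<lambda>x. ereal (L bot) + enn2ereal (g x)) \<le> ereal C"
proof -
  let ?F = "vimage_algebra (space M) a borel"
  interpret sigma_finite_subalgebra M ?F
    by (rule sigma_finite_subalgebra_vimage) simp
  have "\<rho> (gen_cond_exp M ?F (\<lambda>x. L (test_at \<phi> a x))) = \<rho> (\<lambda>x. ereal (L bot) + enn2ereal (g x))"
  proof (rule rho_cong)
    show "gen_cond_exp M ?F (\<lambda>x. L (test_at \<phi> a x)) \<in> borel_measurable M"
      unfolding gen_cond_exp_def by measurable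
    have "AE x in M. gen_cond_exp M ?F (\<lambda>x. L bot + (L (test_at \<phi> a x) - L bot)) x
        = ereal (L bot) + enn2ereal (nn_cond_exp M ?F (\<lambda>x. ennreal (L (test_at \<phi> a x) - L bot)) x)"
      by (rule gen_cond_exp_add_const) (auto simp: L_bot_le)
    then show "AE x in M. gen_cond_exp M ?F (\<lambda>x. L (test_at \<phi> a x)) x
        = ereal (L bot) + enn2ereal (g x)"
      using eq by eventually_elim simp
    show "AE x in M. ereal (L bot) \<le> ereal (L bot) + enn2ereal (g x)"
      by (intro AE_I2 ereal_le_add_self) simp
  qed measurable
  then show ?thesis by (simp add: loss_valid_def)
qed

text \<open>Given \<open>V\<close>, the region is hit with probability \<open>q V\<close> and a hit
  costs the excess loss \<open>w V\<close>, so the conditional excess loss is their product. The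
  function \<open>w\<close> only has to agree with the excess loss at values of \<open>V\<close>:
  \<open>d\<close> is unspecified outside the unit interval, and for a constant level a constant
  \<open>w\<close> suffices.\<close>

lemma region:
  fixes U V q w :: "_ \<Rightarrow> real"
  assumes indep: "indep_var borel U borel V"
    and U: "distr M borel U = uniform_measure lborel {0..1}"
    and V: "data_level M V"
    and [measurable]: "q \<in> borel_measurable borel" "w \<in> borel_measurable borel"
    and q: "\<And>x. x \<in> space M \<Longrightarrow> q (V x) \<in> {0..1}"
    and w: "\<And>x. x \<in> space M \<Longrightarrow> L (d (V x)) - L bot = w (V x)"
    and R: "R = {x \<in> space M. U x \<le> q (V x)}"
  shows sets_region: "R \<in> sets M"
    and measure_region: "measure M R = (\<integral>x. q (V x) \<partial>M)"
    and loss_valid_region: "loss_valid M \<rho> L C (region_tests d R) V \<longleftrightarrow>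
      \<rho> (\<lambda>x. ereal (L bot) + enn2ereal (ennreal (w (V x) * q (V x)))) \<le> ereal C"
proof -
  have [measurable]: "random_variable borel U" "random_variable borel V"
    using indep_var_rv1[OF indep] indep_var_rv2[OF indep] by auto
  show R_sets [measurable]: "R \<in> sets M" unfolding R by measurable
  have "emeasure M R = (\<integral>\<^sup>+x. 1 * indicator {..q (V x)} (U x) \<partial>M)"
  proof -
    have "emeasure M R = (\<integral>\<^sup>+x. indicator R x \<partial>M)" by simp
    also have "\<dots> = (\<integral>\<^sup>+x. 1 * indicator {..q (V x)} (U x) \<partial>M)"
      by (intro nn_integral_cong) (auto simp: R indicator_def)
    finally show ?thesis .
  qed
  also have "\<dots> = (\<integral>\<^sup>+x. 1 * ennreal (q (V x)) \<partial>M)"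
    by (rule nn_integral_uniform_threshold[OF indep U, of "\<lambda>_. 1"]) (use q in auto)
  also have "\<dots> = ennreal (\<integral>x. q (V x) \<partial>M)"
  proof -
    have "integrable M (\<lambda>x. q (V x))"
      using q by (intro integrable_const_bound[where B = 1]) auto
    then show ?thesis using q by (simp add: nn_integral_eq_integral)
  qed
  finally show "measure M R = (\<integral>x. q (V x) \<partial>M)"
    using q by (simp add: measure_def integral_nonneg_AE)
  have eq: "L (test_at (region_tests d R) V x) = L bot + w (V x) * indicator R x" if "x \<in> space M" for x
    using w[OF that] by (auto simp: test_at_def region_tests_def indicator_def)
  have w_nonneg: "0 \<le> w (V x)" if "x \<in> space M" for x
    using w[OF that] L_bot_le[of "d (V x)"] by simp
  show "loss_valid M \<rho> L C (region_tests d R) V \<longleftrightarrow>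
      \<rho> (\<lambda>x. ereal (L bot) + enn2ereal (ennreal (w (V x) * q (V x)))) \<le> ereal C"
  proof (rule loss_valid_iff)
    let ?F = "vimage_algebra (space M) V borel"
    interpret sigma_finite_subalgebra M ?F
      by (rule sigma_finite_subalgebra_vimage) simp
    show L_meas [measurable]: "(\<lambda>x. L (test_at (region_tests d R) V x)) \<in> borel_measurable M"
      by (subst measurable_cong[OF eq]) auto
    have eq': "ennreal (L (test_at (region_tests d R) V x) - L bot)
        = ennreal (w (V x)) * indicator {..q (V x)} (U x)" if "x \<in> space M" for x
      unfolding eq[OF that] using that by (auto simp: R indicator_def)
    have "(\<lambda>x. ennreal (w (V x)) * indicator {..q (V x)} (U x)) \<in> borel_measurable M"
      by (subst measurable_cong[OF eq'[symmetric]]) auto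
    then have "AE x in M. nn_cond_exp M ?F (\<lambda>x. ennreal (L (test_at (region_tests d R) V x) - L bot)) x
        = nn_cond_exp M ?F (\<lambda>x. ennreal (w (V x)) * indicator {..q (V x)} (U x)) x"
      by (intro nn_cond_exp_cong) (auto simp: eq')
    moreover have "AE x in M. nn_cond_exp M ?F (\<lambda>x. ennreal (w (V x)) * indicator {..q (V x)} (U x)) x
        = ennreal (w (V x)) * ennreal (q (V x))"
      by (rule nn_cond_exp_uniform_threshold[OF indep U, of "\<lambda>v. ennreal (w v)"]) (use q in auto)
    ultimately show "AE x in M. nn_cond_exp M ?F (\<lambda>x. ennreal (L (test_at (region_tests d R) V x) - L bot)) x
        = ennreal (w (V x) * q (V x))"
      using AE_space by eventually_elim (use q in \<open>auto simp: ennreal_mult w_nonneg\<close>)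
  qed measurable
qed

lemma valid_const_region:
  assumes R: "R \<in> sets M" and \<alpha>: "\<alpha> \<in> {0<..<1}"
  shows "loss_valid M \<rho> L C (region_tests d R) (\<lambda>_. \<alpha>) \<longleftrightarrow> measure M R \<le> \<alpha>"
proof -
  have "test_family M d (region_tests d R)"
    using admissible_region_tests[OF R, of "\<lambda>_. \<alpha>"] \<alpha> by (simp add: admissible_def data_level_def)
  moreover have "{x \<in> space M. region_tests d R \<alpha> x = d \<alpha>} = R"
    using d_neq_bot[OF \<alpha>] sets.sets_into_space[OF R] by (auto simp: region_tests_def)
  ultimately show ?thesis using nests \<alpha> by (simp add: nests_classical_def)
qed

text \<open>At a constant level the conditional loss is constant and thus its own certainty
  equivalent. Nesting then turns validity into an equivalence between two linear inequalities in the
  rejection probability \<open>p\<close>, which fixes the slope \<open>D\<close>.\<close>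

lemma loss_level:
  assumes \<alpha>: "\<alpha> \<in> {0<..<1}"
  shows "L (d \<alpha>) - L bot = (C - L bot) / \<alpha>"
proof -
  define D where "D = L (d \<alpha>) - L bot"
  obtain U where U: "distr M borel U = uniform_measure lborel {0..1}" "indep_var borel U borel (\<lambda>_. \<alpha>)"
    using rich_uniform[OF prob_space_axioms rich, of "\<lambda>_. \<alpha>"] by auto
  have *: "D * p \<le> C - L bot \<longleftrightarrow> p \<le> \<alpha>" if p: "p \<in> {0..1}" for p
  proof -
    let ?R = "{x \<in> space M. U x \<le> p}"
    have lvl: "data_level M (\<lambda>_. \<alpha>)" using \<alpha> by (simp add: data_level_def)
    note reg = region[OF U(2,1) lvl, of "\<lambda>_. p" "\<lambda>_. D" ?R]
    have "p \<le> \<alpha> \<longleftrightarrow> loss_valid M \<rho> L C (region_tests d ?R) (\<lambda>_. \<alpha>)"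
      using reg(1,2) p \<alpha> valid_const_region[of ?R] by (simp add: D_def prob_space)
    also have "\<dots> \<longleftrightarrow> \<rho> (\<lambda>_. ereal (L bot) + enn2ereal (ennreal (D * p))) \<le> ereal C"
      using reg(3) p by (simp add: D_def)
    also have "\<dots> \<longleftrightarrow> \<rho> (\<lambda>_. ereal (L bot + D * p)) \<le> ereal C"
      using p L_bot_le by (simp add: enn2ereal_ennreal D_def)
    also have "\<rho> (\<lambda>_. ereal (L bot + D * p)) = ereal (L bot + D * p)"
      using certainty p L_bot_le by (simp add: certainty_equivalent_def rv_above_def D_def)
    finally show ?thesis by auto
  qed
  have "D * \<alpha> \<le> C - L bot" using *[of \<alpha>] \<alpha> by simp
  \<comment> \<open>Rejecting always is invalid because 1 exceeds \<alpha>. This makes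
    \<open>(C - L bot) / D\<close> a probability, at which the loss bound holds with
    equality.\<close>
  moreover have "D > C - L bot" using *[of 1] \<alpha> by auto
  then have "(C - L bot) / D \<le> \<alpha>"
    using *[of "(C - L bot) / D"] L_bot_less by simp
  then have "C - L bot \<le> D * \<alpha>"
    using \<open>D > C - L bot\<close> L_bot_less by (simp add: field_simps)
  ultimately show ?thesis using \<alpha> by (simp add: D_def field_simps)
qed

section \<open>Validity as a bound on the expected excess loss\<close>

text \<open>With \<open>V\<close> between \<open>lo\<close> and \<open>hi\<close>, the mean of
  \<open>z V\<close> lies between \<open>lo\<close> and \<open>hi\<close> times that of
  \<open>z\<close>, so each direction loses only the factor \<open>hi / lo\<close>. The condition
  \<open>hi * B \<le> C - L bot\<close> keeps the conditional rejection probability at most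
  1.\<close>

lemma bounded_risk:
  fixes z :: "'a \<Rightarrow> real"
  assumes z [measurable]: "z \<in> borel_measurable M" and bounds: "\<And>x. 0 \<le> z x" "\<And>x. z x \<le> B"
    and lvl: "0 < lo" "lo < hi" "hi < 1" "0 < B" "hi * B \<le> C - L bot"
  shows expectation_le_if_preserving:
      "\<lbrakk>preserves_classical M d (loss_valid M \<rho> L C);
        \<rho> (\<lambda>x. ereal (L bot) + enn2ereal (ennreal (z x))) \<le> ereal C\<rbrakk>
      \<Longrightarrow> lo * (\<integral>x. z x \<partial>M) \<le> hi * (C - L bot)"
    and risk_le_if_monotone:
      "\<lbrakk>monotone_validity M d (loss_valid M \<rho> L C); hi * (\<integral>x. z x \<partial>M) \<le> lo * (C - L bot)\<rbrakk>
      \<Longrightarrow> \<rho> (\<lambda>x. ereal (L bot) + enn2ereal (ennreal (z x))) \<le> ereal C"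
proof -
  define K where "K = C - L bot"
  have K: "0 < K" using L_bot_less by (simp add: K_def)
  \<comment> \<open>The affine encoding is injective in \<open>z\<close>, so conditioning on
    \<open>V\<close> retains all of \<open>z\<close>.\<close>
  define V where "V = (\<lambda>x. lo + (hi - lo) * (z x / B))"
  have V_bounds: "lo \<le> V x" "V x \<le> hi" for x
  proof -
    have "0 \<le> z x / B" "z x / B \<le> 1" using bounds[of x] lvl by auto
    then show "lo \<le> V x" "V x \<le> hi"
      using lvl mult_left_le[of "z x / B" "hi - lo"] mult_nonneg_nonneg[of "hi - lo" "z x / B"]
      by (auto simp: V_def)
  qed
  have V01: "V x \<in> {0<..<1}" for x using V_bounds[of x] lvl by auto
  have [measurable]: "V \<in> borel_measurable M" unfolding V_def by measurable
  have V: "data_level M V" using V01 by (simp add: data_level_def)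
  \<comment> \<open>The factor \<open>(v - lo) * B / (hi - lo)\<close> decodes \<open>z\<close>; the
    factor \<open>v / K\<close> cancels the excess loss \<open>K / v\<close> of a rejection at level
    \<open>v\<close>.\<close>
  define q where "q = (\<lambda>v. (v - lo) * B / (hi - lo) * v / K)"
  have zV: "(V x - lo) * B / (hi - lo) = z x" for x using lvl by (simp add: V_def)
  then have q_V: "q (V x) = z x * V x / K" for x by (simp only: q_def)
  have zV_le: "z x * V x \<le> hi * z x" "lo * z x \<le> z x * V x" for x
    using mult_left_mono[OF V_bounds(2) bounds(1)] mult_left_mono[OF V_bounds(1) bounds(1)]
    by (simp_all add: mult.commute)
  have zV_le_B: "z x * V x \<le> hi * B" for x
    using zV_le(1)[of x] by (rule order_trans) (use bounds(2) lvl in \<open>simp add: mult_left_mono\<close>)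
  have q01: "q (V x) \<in> {0..1}" for x
  proof -
    have "z x * V x \<le> K"
      using zV_le_B[of x] lvl unfolding K_def by linarith
    then show ?thesis using bounds(1)[of x] V01[of x] K by (simp add: q_V)
  qed
  obtain U where U: "distr M borel U = uniform_measure lborel {0..1}" "indep_var borel U borel V"
    using rich_uniform[OF prob_space_axioms rich] \<open>V \<in> borel_measurable M\<close> by blast
  define R where "R = {x \<in> space M. U x \<le> q (V x)}"
  have "q \<in> borel_measurable borel" "(\<lambda>v. K / v) \<in> borel_measurable borel"
    unfolding q_def by measurable
  note reg = region[OF U(2,1) V this q01 _ R_def, unfolded q_V]
  have w: "L (d (V x)) - L bot = K / V x" for x
    using loss_level[OF V01] by (simp add: K_def)
  note R [measurable] = reg(1)[OF w]
  have prob_R: "measure M R = (\<integral>x. z x * V x \<partial>M) / K"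
    using reg(2)[OF w] by simp
  have "K / V x * (z x * V x / K) = z x" for x
    using K V01[of x] by simp
  then have valid_R: "loss_valid M \<rho> L C (region_tests d R) V \<longleftrightarrow>
      \<rho> (\<lambda>x. ereal (L bot) + enn2ereal (ennreal (z x))) \<le> ereal C"
    using reg(3)[OF w] by simp
  have int_z: "integrable M z"
    using bounds by (intro integrable_const_bound[where B = B]) auto
  have int_zV: "integrable M (\<lambda>x. z x * V x)"
  proof (rule integrable_const_bound[where B = "hi * B"])
    have "0 \<le> V x" for x using V01[of x] by simp
    then show "AE x in M. norm (z x * V x) \<le> hi * B"
      using zV_le_B bounds(1) by (simp add: abs_mult)
  qed simp
  have adm: "admissible M d (region_tests d R) V"
    by (rule admissible_region_tests[OF R V])
  show "lo * (\<integral>x. z x \<partial>M) \<le> hi * (C - L bot)"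
    if pres: "preserves_classical M d (loss_valid M \<rho> L C)"
      and z_le: "\<rho> (\<lambda>x. ereal (L bot) + enn2ereal (ennreal (z x))) \<le> ereal C"
  proof -
    have hi: "hi \<in> {0<..<1}" using lvl by simp
    \<comment> \<open>No level exceeds \<open>hi\<close>, so every rejection is at least as strong
      as \<open>d hi\<close>.\<close>
    have "{x \<in> space M. d hi \<le> test_at (region_tests d R) V x} = R"
      using sets.sets_into_space[OF R] V_bounds by (auto simp: test_at_region_le_iff[where a = V, OF hi V01])
    then have "measure M R \<le> hi"
      using pres adm valid_R z_le hi unfolding preserves_classical_def by metis
    then have "(\<integral>x. z x * V x \<partial>M) \<le> hi * K"
      using K by (simp add: prob_R field_simps)
    moreover have "(\<integral>x. lo * z x \<partial>M) \<le> (\<integral>x. z x * V x \<partial>M)"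
      by (intro integral_mono int_zV integrable_mult_right int_z zV_le)
    ultimately show ?thesis by (simp add: K_def)
  qed
  show "\<rho> (\<lambda>x. ereal (L bot) + enn2ereal (ennreal (z x))) \<le> ereal C"
    if mono_valid: "monotone_validity M d (loss_valid M \<rho> L C)"
      and z_le: "hi * (\<integral>x. z x \<partial>M) \<le> lo * (C - L bot)"
  proof -
    have lo: "lo \<in> {0<..<1}" using lvl by simp
    have "(\<integral>x. z x * V x \<partial>M) \<le> (\<integral>x. hi * z x \<partial>M)"
      by (intro integral_mono int_zV integrable_mult_right int_z zV_le)
    then have "measure M R \<le> lo"
      using z_le K by (simp add: prob_R K_def field_simps)
    then have "loss_valid M \<rho> L C (region_tests d R) (\<lambda>_. lo)"
      using valid_const_region[OF R lo] by simp
    moreover have "admissible M d (region_tests d R) (\<lambda>_. lo)"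
      by (rule admissible_region_tests[OF R]) (use lo in \<open>simp add: data_level_def\<close>)
    \<comment> \<open>On the same region, the level \<open>lo\<close> gives the stronger rejection
      because \<open>V\<close> is never below it.\<close>
    moreover have "test_at (region_tests d R) V x \<le> test_at (region_tests d R) (\<lambda>_. lo) x" for x
      using V_bounds[of x] by (simp add: test_at_def region_tests_def d_le_iff[OF V01 lo])
    ultimately have "loss_valid M \<rho> L C (region_tests d R) V"
      using mono_valid adm unfolding monotone_validity_def by blast
    then show ?thesis by (simp add: valid_R)
  qed
qed

text \<open>Truncation supplies the boundedness that \<open>bounded_risk\<close> demands, and a
  factor below 1 supplies the slack for \<open>lo < hi\<close>. The approximations increase to
  \<open>Z\<close>, so continuity from below for \<open>\<rho>\<close> and monotone convergence for
  the integral recover the sharp bound, equality included.\<close>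

lemma risk_le_iff:
  fixes Z :: "'a \<Rightarrow> ennreal"
  assumes Z [measurable]: "Z \<in> borel_measurable M"
    and cont: "continuous_from_below M (L bot) \<rho>"
    and pres: "preserves_classical M d (loss_valid M \<rho> L C)"
    and mono_valid: "monotone_validity M d (loss_valid M \<rho> L C)"
  shows "\<rho> (\<lambda>x. ereal (L bot) + enn2ereal (Z x)) \<le> ereal C \<longleftrightarrow> (\<integral>\<^sup>+x. Z x \<partial>M) \<le> ennreal (C - L bot)"
proof -
  define K where "K = C - L bot"
  have K: "0 < K" using L_bot_less by (simp add: K_def)
  define c where "c = (\<lambda>n. real (Suc n) / real (Suc (Suc n)))"
  have c: "0 < c n" "c n < 1" for n by (simp_all add: c_def)
  have c_mono: "c m \<le> c n" if "m \<le> n" for m n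
    using that by (simp add: c_def field_simps)
  \<comment> \<open>The minimum is finite, so \<open>enn2real\<close> loses nothing even where
    \<open>Z\<close> is \<open>top\<close>.\<close>
  define z where "z = (\<lambda>n x. enn2real (min (Z x) (ennreal (real (Suc n)))) * c n)"
  have [measurable]: "z n \<in> borel_measurable M" for n unfolding z_def by measurable
  have z_nonneg: "0 \<le> z n x" for n x using c[of n] by (simp add: z_def)
  have z_le: "z n x \<le> real (Suc n)" for n x
  proof -
    have "enn2real (min (Z x) (ennreal (real (Suc n)))) \<le> real (Suc n)"
      by (rule enn2real_leI) auto
    then have "z n x \<le> real (Suc n) * 1"
      unfolding z_def using c[of n] by (intro mult_mono) auto
    then show ?thesis by simp
  qed
  have ennreal_z: "ennreal (z n x) = min (Z x) (ennreal (real (Suc n))) * ennreal (c n)" for n x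
    using c[of n] by (simp add: z_def ennreal_mult ennreal_enn2real_if min_def top_unique)
  have z_mono: "ennreal (z m x) \<le> ennreal (z n x)" if "m \<le> n" for m n x
    unfolding ennreal_z using that c_mono[OF that]
    by (intro mult_mono min.mono ennreal_leI) auto
  have c_lim: "c \<longlonglongrightarrow> 1" unfolding c_def by real_asymp
  have z_lim: "(\<lambda>n. ennreal (z n x)) \<longlonglongrightarrow> Z x" for x
  proof (cases "Z x")
    case (real r)
    have "\<forall>\<^sub>F n in sequentially. z n x = r * c n"
      using eventually_ge_at_top[of "nat \<lceil>r\<rceil>"]
    proof eventually_elim
      case (elim n)
      then have "r \<le> real (Suc n)" by linarith
      then have "min (Z x) (ennreal (real (Suc n))) = ennreal r"
        unfolding real by (intro min_absorb1 ennreal_leI)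
      then show ?case using real(1) by (simp only: z_def enn2real_ennreal)
    qed
    moreover have "(\<lambda>n. r * c n) \<longlonglongrightarrow> r" using tendsto_mult_left[OF c_lim, of r] by simp
    ultimately have "(\<lambda>n. z n x) \<longlonglongrightarrow> r" by (simp add: filterlim_cong)
    then show ?thesis by (simp add: real)
  next
    case top
    have "z n x = real (Suc n) * (real (Suc n) / real (Suc (Suc n)))" for n
      by (simp add: z_def top c_def)
    moreover have "filterlim (\<lambda>n. real (Suc n) * (real (Suc n) / real (Suc (Suc n)))) at_top sequentially"
      by real_asymp
    ultimately show ?thesis by (simp add: top ennreal_tendsto_top_eq_at_top)
  qed
  let ?T = "\<lambda>f x. ereal (L bot) + enn2ereal (f x)"
  have "incseq (\<lambda>n. \<rho> (?T (\<lambda>x. ennreal (z n x)))) \<and> (\<lambda>n. \<rho> (?T (\<lambda>x. ennreal (z n x)))) \<longlonglongrightarrow> \<rho> (?T Z)"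
  proof (rule cont[unfolded continuous_from_below_def, rule_format], intro conjI allI AE_I2)
    have rv: "?T f \<in> rv_above M (L bot)" if [measurable]: "f \<in> borel_measurable M" for f
      by (auto simp: rv_above_def intro!: AE_I2 ereal_le_add_self)
    show "?T (\<lambda>x. ennreal (z n x)) \<in> rv_above M (L bot)" for n by (rule rv) simp
    show "?T Z \<in> rv_above M (L bot)" by (rule rv) simp
    show "incseq (\<lambda>n. ?T (\<lambda>x. ennreal (z n x)) x)" for x
      unfolding incseq_def using z_mono by (auto intro!: add_left_mono simp: less_eq_ennreal.rep_eq[symmetric])
    show "(\<lambda>n. ?T (\<lambda>x. ennreal (z n x)) x) \<longlonglongrightarrow> ?T Z x" for x
      by (intro tendsto_add_ereal_nonneg tendsto_const tendsto_enn2erealI z_lim) auto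
  qed
  then have rho_mono: "incseq (\<lambda>n. \<rho> (?T (\<lambda>x. ennreal (z n x))))"
    and rho_lim: "(\<lambda>n. \<rho> (?T (\<lambda>x. ennreal (z n x)))) \<longlonglongrightarrow> \<rho> (?T Z)" by auto
  have int_z: "(\<integral>\<^sup>+x. ennreal (z n x) \<partial>M) = ennreal (\<integral>x. z n x \<partial>M)" for n
    using z_nonneg z_le
    by (intro nn_integral_eq_integral integrable_const_bound[where B = "real (Suc n)"]) auto
  \<comment> \<open>This is \<open>hi\<close> for the bound \<open>B = Suc n\<close>: the first
    entry keeps it below 1, the second gives \<open>hi * B \<le> K\<close>.\<close>
  define h where "h n = min (1 / 2) (K / real (Suc n))" for n
  have h: "0 < h n" "h n < 1" "h n * real (Suc n) \<le> C - L bot" for n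
  proof -
    show "0 < h n" "h n < 1" using K by (auto simp: h_def)
    have "h n * real (Suc n) \<le> K / real (Suc n) * real (Suc n)"
      unfolding h_def by (intro mult_right_mono) auto
    then show "h n * real (Suc n) \<le> C - L bot" by (simp add: K_def)
  qed
  have th: "0 < t * h n" "t * h n < h n" if "0 < t" "t < 1" for t n
    using that h(1)[of n] by simp_all
  note bnd = z_nonneg z_le
  have pos: "0 < real (Suc n)" for n by simp
  show ?thesis
  proof
    assume valid: "\<rho> (?T Z) \<le> ereal C"
    have "(\<integral>\<^sup>+x. ennreal (z n x) \<partial>M) \<le> ennreal K" for n
    proof -
      have n: "\<rho> (?T (\<lambda>x. ennreal (z n x))) \<le> ereal C"
        using incseq_le[OF rho_mono rho_lim] valid by (rule order_trans)
      \<comment> \<open>With \<open>lo = t * h n\<close> the factor \<open>h n\<close> cancels, and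
        \<open>t\<close> may then approach 1 for fixed \<open>n\<close>.\<close>
      have "t * (\<integral>x. z n x \<partial>M) \<le> K" if t: "0 < t" "t < 1" for t
      proof -
        have "(t * h n) * (\<integral>x. z n x \<partial>M) \<le> h n * (C - L bot)"
          by (rule expectation_le_if_preserving[OF _ bnd th[OF t] h(2) pos h(3) pres n]) simp
        then have "h n * (t * (\<integral>x. z n x \<partial>M)) \<le> h n * K"
          by (simp add: K_def mult_ac)
        then show ?thesis using h(1)[of n] by (simp only: mult_le_cancel_left_pos)
      qed
      then have "(\<integral>x. z n x \<partial>M) \<le> K" by (rule field_le_mult_one_interval)
      then show ?thesis unfolding int_z by (rule ennreal_leI)
    qed
    moreover have "(\<lambda>n. \<integral>\<^sup>+x. ennreal (z n x) \<partial>M) \<longlonglongrightarrow> (\<integral>\<^sup>+x. Z x \<partial>M)"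
      by (rule nn_integral_LIMSEQ) (auto simp: incseq_def le_fun_def z_mono z_lim)
    ultimately show "(\<integral>\<^sup>+x. Z x \<partial>M) \<le> ennreal (C - L bot)"
      unfolding K_def by (intro LIMSEQ_le_const2) auto
  next
    assume Z_le: "(\<integral>\<^sup>+x. Z x \<partial>M) \<le> ennreal (C - L bot)"
    have "\<rho> (?T (\<lambda>x. ennreal (z n x))) \<le> ereal C" for n
    proof -
      \<comment> \<open>The shrinking factor \<open>c n\<close> is exactly the ratio
        \<open>lo / hi\<close> chosen below, so the bound on the mean of \<open>Z\<close> meets the
        hypothesis of the monotonicity direction.\<close>
      have "ennreal (\<integral>x. z n x \<partial>M) \<le> (\<integral>\<^sup>+x. Z x * ennreal (c n) \<partial>M)"
        unfolding int_z[symmetric] ennreal_z by (intro nn_integral_mono mult_right_mono) auto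
      also have "\<dots> \<le> ennreal (C - L bot) * ennreal (c n)"
        using Z_le by (simp add: nn_integral_multc mult_right_mono)
      also have "\<dots> = ennreal ((C - L bot) * c n)"
        using K c[of n] by (simp add: K_def ennreal_mult)
      finally have "(\<integral>x. z n x \<partial>M) \<le> (C - L bot) * c n"
        using K c[of n] by (simp add: K_def ennreal_le_iff)
      then have "h n * (\<integral>x. z n x \<partial>M) \<le> h n * ((C - L bot) * c n)"
        using h(1)[of n] by (simp only: mult_le_cancel_left_pos)
      also have "\<dots> = (c n * h n) * (C - L bot)"
        by (simp add: mult_ac)
      finally have "h n * (\<integral>x. z n x \<partial>M) \<le> (c n * h n) * (C - L bot)" .
      then show ?thesis
        by (rule risk_le_if_monotone[OF _ bnd th[OF c] h(2) pos h(3) mono_valid, rotated]) simp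
    qed
    then show "\<rho> (?T Z) \<le> ereal C"
      using rho_lim by (intro LIMSEQ_le_const2) auto
  qed
qed

end

section \<open>Validity of E-values\<close>

theorem corollary7:
  fixes M :: "'a measure"
    and d :: "real \<Rightarrow> 'd::{linorder, order_bot}"
    and \<rho> :: "('a \<Rightarrow> ereal) \<Rightarrow> ereal"
    and L :: "'d \<Rightarrow> real"
    and C :: real
  assumes "prob_space M"
    and "rich M"
    and "evidence_space d"
    and "mono L"
    and "L bot < C"
    and "certainty_equivalent M (L bot) \<rho>"
    and "continuous_from_below M (L bot) \<rho>"
    and "nests_classical M d (loss_valid M \<rho> L C)"
    and "preserves_classical M d (loss_valid M \<rho> L C)"
    and "monotone_validity M d (loss_valid M \<rho> L C)"
  shows "normalized_loss L C bot = 0 \<and>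
    (\<forall>\<alpha>\<in>{0<..<1}. normalized_loss L C (d \<alpha>) = 1 / \<alpha>) \<and>
    (\<forall>\<epsilon> \<in> M \<rightarrow>\<^sub>M decision_algebra d. \<forall>c\<in>{0<..<1}.
       e_value_valid d (loss_valid M \<rho> L C) c \<epsilon> \<longleftrightarrow>
       (\<integral>\<^sup>+x. ennreal (normalized_loss L C (\<epsilon> x)) \<partial>M) \<le> 1)"
proof -
  interpret nested_loss_validity M d \<rho> L C
    using assms by (simp add: nested_loss_validity_def nested_loss_validity_axioms_def)
  have K: "0 < C - L bot" using L_bot_less by simp
  have "e_value_valid d (loss_valid M \<rho> L C) c \<epsilon> \<longleftrightarrow>
      (\<integral>\<^sup>+x. ennreal (normalized_loss L C (\<epsilon> x)) \<partial>M) \<le> 1"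
    if \<epsilon>: "\<epsilon> \<in> M \<rightarrow>\<^sub>M decision_algebra d" and c: "c \<in> {0<..<1}" for \<epsilon> c
  proof -
    let ?a = "induced_level d c \<epsilon>"
    let ?F = "vimage_algebra (space M) ?a borel"
    let ?Z = "nn_cond_exp M ?F (\<lambda>x. ennreal (L (\<epsilon> x) - L bot))"
    have a [measurable]: "?a \<in> borel_measurable M"
      by (rule measurable_induced_level[OF \<epsilon> c])
    interpret F: sigma_finite_subalgebra M ?F
      by (rule sigma_finite_subalgebra_vimage[OF a])
    have [measurable]: "Measurable.pred M (\<lambda>x. \<epsilon> x = bot)"
      using measurable_eq_bot[OF \<epsilon>] by (simp add: pred_def)
    \<comment> \<open>Off \<open>bot\<close> the loss is an explicit function of the induced level,
      which yields its measurability.\<close>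
    have "L (\<epsilon> x) = L bot + (C - L bot) / ?a x" if "\<epsilon> x \<noteq> bot" for x
      using loss_level[OF induced_level_mem[OF c], of \<epsilon> x] d_induced_level[of \<epsilon> x c] that by simp
    then have "(\<lambda>x. L (\<epsilon> x)) = (\<lambda>x. if \<epsilon> x = bot then L bot else L bot + (C - L bot) / ?a x)"
      by (simp add: fun_eq_iff)
    then have L_meas [measurable]: "(\<lambda>x. L (\<epsilon> x)) \<in> borel_measurable M" by simp
    have "e_value_valid d (loss_valid M \<rho> L C) c \<epsilon> \<longleftrightarrow>
        \<rho> (\<lambda>x. ereal (L bot) + enn2ereal (?Z x)) \<le> ereal C"
      unfolding e_value_valid_def by (rule loss_valid_iff) (simp_all add: test_at_induced[OF c])
    also have "\<dots> \<longleftrightarrow> (\<integral>\<^sup>+x. ?Z x \<partial>M) \<le> ennreal (C - L bot)"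
      by (rule risk_le_iff) (use assms in simp_all)
    \<comment> \<open>Conditional expectation preserves the total integral, so the conditioning on
      the level disappears, and with it the arbitrary \<open>c\<close>.\<close>
    also have "(\<integral>\<^sup>+x. ?Z x \<partial>M) = (\<integral>\<^sup>+x. ennreal (L (\<epsilon> x) - L bot) \<partial>M)"
      using F.nn_cond_exp_intg[of "\<lambda>_. 1"] by simp
    also have "\<dots> = (\<integral>\<^sup>+x. ennreal (C - L bot) * ennreal (normalized_loss L C (\<epsilon> x)) \<partial>M)"
      using K L_bot_le by (intro nn_integral_cong) (simp add: normalized_loss_def flip: ennreal_mult)
    also have "\<dots> = ennreal (C - L bot) * (\<integral>\<^sup>+x. ennreal (normalized_loss L C (\<epsilon> x)) \<partial>M)"
      by (rule nn_integral_cmult) (simp add: normalized_loss_def)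
    also have "\<dots> \<le> ennreal (C - L bot) \<longleftrightarrow> (\<integral>\<^sup>+x. ennreal (normalized_loss L C (\<epsilon> x)) \<partial>M) \<le> 1"
      using K ennreal_mult_le_mult_iff[of "ennreal (C - L bot)" _ 1] by simp
    finally show ?thesis .
  qed
  moreover have "normalized_loss L C (d \<alpha>) = 1 / \<alpha>" if "\<alpha> \<in> {0<..<1}" for \<alpha>
    using loss_level[OF that] K by (simp add: normalized_loss_def)
  ultimately show ?thesis by (simp add: normalized_loss_def)
qed

end
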